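(* Let $n=2^m p_1^{r_1}\cdots p_s^{r_s}$ with $m\ge 0$, $s>0$, $p_1,\dots,p_s$ distinct odd primes and $r_1,\dots,r_s\ge 1$. Then $n\in\mathcal{M}_{\frac{\lambda}{2}}$ if and only if one of these conditions holds: (i) $m=0$ and $\mathcal{E}(p_i-1)=\mathcal{E}(p_j-1)$ for every $i,j$; (ii) $m=2$ or $m=3$, $\mathcal{E}(p_i-1)=1$ for every $i$, and $\frac{n}{2^m}\neq 3$.
   Context: $\lambda$ is the Carmichael function ($\lambda(n)$ is the exponent of the group of units of $\mathbb{Z}/n\mathbb{Z}$); $\lambda(n)/2$ is a positive integer for $n\ge 3$. For positive integers $n,k$, $S_k(n):=\sum_{j=1}^n j^k$. $\mathcal{M}_{\frac{\lambda}{2}}$ is the set of integers $n\ge 3$ such that $n$ divides $S_{\lambda(n)/2}(n)$. For a positive integer $m$, $\mathcal{E}(m):=\max\{k\ge 0: 2^k \text{ divides } m\}$. *)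

theory Defs
  imports "HOL-Number_Theory.Number_Theory"
begin

definition power_sum :: "nat \<Rightarrow> nat \<Rightarrow> nat" where
  "power_sum k n = (\<Sum>j=1..n. j ^ k)"

text \<open>
  The exponent \<open>\<lambda>(n) / 2\<close> below is rendered by natural-number division, which
  is exact for \<open>n \<ge> 3\<close>:
\<close>

lemma even_Carmichael:
  assumes "n \<ge> 3"
  shows "even (Carmichael n)"
proof -
  have cop: "coprime n (n - 1)"
    using assms coprime_diff_one_right_nat[of n] by simp
  have sq: "[(n - 1) ^ 2 = 1] (mod n)"
  proof -
    have "(n - 1) ^ 2 = 1 + n * (n - 2)"
      using assms by (cases n) (auto simp: power2_eq_square algebra_simps diff_Suc split: nat.splits)
    thus ?thesis unfolding cong_def by (metis mod_mult_self2)
  qed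
  have "ord n (n - 1) dvd 2" using sq by (simp add: ord_divides')
  moreover have "ord n (n - 1) \<noteq> 1"
  proof
    assume "ord n (n - 1) = 1"
    hence "[(n - 1) ^ 1 = 1] (mod n)" using ord_works[of "n - 1" n] by metis
    thus False using assms by (simp add: cong_def)
  qed
  ultimately have "ord n (n - 1) = 2"
    using primes_dvd_imp_eq two_is_prime_nat prime_nat_iff by metis
  moreover have "ord n (n - 1) dvd Carmichael n"
    using assms cop by (intro ord_dvd_Carmichael) auto
  ultimately show ?thesis by simp
qed

definition M_half_lambda :: "nat set" where
  "M_half_lambda = {n. n \<ge> 3 \<and> n dvd power_sum (Carmichael n div 2) n}"

end

theory Submission
  imports Defs
begin

text \<open>
  Write \<open>k = \<lambda>(n) / 2\<close> and \<open>E\<close> for the exponent of \<open>2\<close> in \<open>\<lambda>(n)\<close>.  By coprimality,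
  \<open>n\<close> divides the power sum iff every prime power \<open>q\<close> exactly dividing \<open>n\<close>
  does.  Modulo such a \<open>q\<close>, the summands run \<open>n / q\<close> times through all residues, and \<open>n / q\<close> is
  invertible, so the question is whether \<open>q\<close> divides the sum of the \<open>k\<close>-th powers of all
  residues modulo \<open>q\<close>.

  For odd \<open>p\<close> or even \<open>k\<close> this local question has the same answer for \<open>p ^ r\<close> as for \<open>p\<close>:
  lifting from \<open>q\<close> to \<open>p * q\<close> multiplies the residue power sum by \<open>p\<close> modulo \<open>p * q\<close>, up to a
  correction term which then vanishes (\<open>dvd_residue_power_sum_mult_step\<close>).  Modulo \<open>p\<close> itself,
  Fermat's theorem and the existence of a primitive root show that the sum vanishes iff \<open>p - 1\<close>
  does not divide \<open>k\<close>
  (\<open>prime_dvd_residue_power_sum_iff\<close>).  For an odd prime \<open>p\<close> dividing \<open>n\<close>, the number \<open>p - 1\<close>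
  divides \<open>\<lambda>(n)\<close>, and so it fails to divide \<open>k\<close> precisely when \<open>p - 1\<close> contains the full power
  \<open>2 ^ E\<close> (\<open>dvd_half_iff_multiplicity_less\<close>).

  For \<open>n\<close> odd, \<open>E\<close> is the largest of the exponents of \<open>2\<close> in the numbers \<open>p - 1\<close>, and the
  conditions say that all of these agree.  For \<open>n\<close> even, the prime \<open>2\<close> contributes the condition
  that \<open>k\<close> is odd, that \<open>k \<ge> 3\<close>, and that \<open>4\<close> divides \<open>n\<close>
  (\<open>two_power_dvd_residue_power_sum_iff\<close>).  Now \<open>k\<close> odd means \<open>E = 1\<close>, which excludes
  \<open>16\<close> as a divisor of \<open>n\<close>, because \<open>\<lambda>(2 ^ m) = 2 ^ (m - 2)\<close> for \<open>m \<ge> 4\<close>.  The exceptional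
  case \<open>k = 1\<close> means \<open>\<lambda>(n) = 2\<close>, so that \<open>2\<close> has order at most \<open>2\<close> modulo the odd part of \<open>n\<close>;
  this forces the odd part to divide \<open>2\<^sup>2 - 1 = 3\<close>.
\<close>

section \<open>Power sums over all residues\<close>

definition residue_power_sum :: "nat \<Rightarrow> nat \<Rightarrow> nat" where
  "residue_power_sum k q = (\<Sum>j<q. j ^ k)"

lemma power_sum_conv_residue_power_sum:
  assumes "k > 0"
  shows "power_sum k n = residue_power_sum k n + n ^ k"
proof -
  have "power_sum k n = (\<Sum>j\<in>{..n}. j ^ k)"
    unfolding power_sum_def using assms
    by (intro sum.mono_neutral_left) (auto simp: Suc_le_eq)
  thus ?thesis
    by (simp add: residue_power_sum_def lessThan_Suc_atMost[symmetric])
qed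

lemma dvd_power_sum_iff:
  assumes "k > 0" and "q dvd n"
  shows "q dvd power_sum k n \<longleftrightarrow> q dvd residue_power_sum k n"
proof -
  have "q dvd n ^ k"
    using assms(2) dvd_power[of k n] assms(1) by (blast intro: dvd_trans)
  thus ?thesis
    using assms(1) by (simp add: power_sum_conv_residue_power_sum dvd_add_left_iff)
qed

lemma residue_power_sum_mult:
  "residue_power_sum k (c * q) = (\<Sum>b<c. \<Sum>a<q. (a + b * q) ^ k)"
proof -
  have "residue_power_sum k (c * q) = (\<Sum>b<c. \<Sum>j\<in>{b * q..<b * q + q}. j ^ k)"
    unfolding residue_power_sum_def by (rule sum.nat_group[symmetric])
  also have "\<dots> = (\<Sum>b<c. \<Sum>a<q. (a + b * q) ^ k)"
  proof (rule sum.cong)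
    fix b
    show "(\<Sum>j\<in>{b * q..<b * q + q}. j ^ k) = (\<Sum>a<q. (a + b * q) ^ k)"
      using sum.shift_bounds_nat_ivl[of "\<lambda>j. j ^ k" 0 "b * q" q]
      by (simp add: add.commute lessThan_atLeast0)
  qed simp
  finally show ?thesis .
qed

text \<open>The summand \<open>j ^ k\<close> is periodic in \<open>j\<close> modulo \<open>q\<close>, and the range consists of \<open>c\<close> periods.\<close>

lemma residue_power_sum_mult_cong:
  "[residue_power_sum k (c * q) = c * residue_power_sum k q] (mod q)"
proof -
  have "[(\<Sum>b<c. \<Sum>a<q. (a + b * q) ^ k) = (\<Sum>b<c. \<Sum>a<q. a ^ k)] (mod q)"
    by (intro cong_sum cong_pow) (simp add: cong_def)
  thus ?thesis
    by (simp add: residue_power_sum_mult) (simp add: residue_power_sum_def)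
qed

lemma dvd_residue_power_sum_mult_coprime_iff:
  assumes "coprime q c"
  shows "q dvd residue_power_sum k (c * q) \<longleftrightarrow> q dvd residue_power_sum k q"
proof -
  have "q dvd residue_power_sum k (c * q) \<longleftrightarrow> q dvd c * residue_power_sum k q"
    using residue_power_sum_mult_cong by (rule cong_dvd_iff)
  also have "\<dots> \<longleftrightarrow> q dvd residue_power_sum k q"
    using assms by (simp add: coprime_dvd_mult_right_iff)
  finally show ?thesis .
qed

section \<open>Lifting from a prime to its powers\<close>

text \<open>The binomial expansion, truncated after the linear term.\<close>

lemma power_add_multiple_cong:
  fixes a b q :: nat
  shows "[(a + b * q) ^ Suc k = a ^ Suc k + Suc k * a ^ k * (b * q)] (mod q ^ 2)"
proof (induction k)
  case (Suc k)
  have "[(a + b * q) * (a + b * q) ^ Suc k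
       = (a + b * q) * (a ^ Suc k + Suc k * a ^ k * (b * q))] (mod q ^ 2)"
    by (intro cong_mult Suc.IH cong_refl)
  also have "(a + b * q) * (a ^ Suc k + Suc k * a ^ k * (b * q))
     = (a ^ Suc (Suc k) + Suc (Suc k) * a ^ Suc k * (b * q)) + q ^ 2 * (Suc k * a ^ k * b ^ 2)"
    by (simp add: algebra_simps power2_eq_square)
  also have "[\<dots> = a ^ Suc (Suc k) + Suc (Suc k) * a ^ Suc k * (b * q)] (mod q ^ 2)"
    by (simp add: cong_def)
  finally show ?case by simp
qed simp

text \<open>
  Split the residues modulo \<open>p * q\<close> as \<open>a + b * q\<close> with \<open>a < q\<close> and \<open>b < p\<close>.  The expansion to
  first order is valid modulo \<open>q\<^sup>2\<close>, hence modulo \<open>p * q\<close>.  Its constant terms add up to \<open>p\<close> times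
  the residue power sum modulo \<open>q\<close>; its linear terms add up to
  \<open>p * q * (k + 1) * (p - 1) / 2\<close> times a power sum with the smaller exponent \<open>k\<close>.  The parity
  assumption says exactly that the factor after \<open>p * q\<close> is an integer.  It is phrased
  in this way, and not as \<open>p\<close> being odd, so that it also covers \<open>p = 2\<close> with an odd exponent
  \<open>k + 1\<close>, once \<open>q\<close> is a power of two and at least \<open>4\<close>.
\<close>

lemma dvd_residue_power_sum_mult_step:
  fixes p q k :: nat
  assumes "p dvd q" and "p > 0" and ev: "even (Suc k * (p - 1) * residue_power_sum k q)"
  shows "p * q dvd residue_power_sum (Suc k) (p * q) \<longleftrightarrow> q dvd residue_power_sum (Suc k) q"
proof -
  define T where "T = residue_power_sum (Suc k) q"
  define U where "U = residue_power_sum k q"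
  have modulus: "p * q dvd q ^ 2"
    using assms(1) by (simp add: power2_eq_square)
  from ev obtain h where h: "Suc k * (p - 1) * U = 2 * h"
    unfolding U_def by (elim evenE)
  have gauss: "2 * (\<Sum>b<p. b) = p * (p - 1)"
    using gauss_sum_nat[of "p - 1"] \<open>p > 0\<close>
    by (cases p) (auto simp: lessThan_Suc_atMost atLeast0AtMost)
  have "[residue_power_sum (Suc k) (p * q)
       = (\<Sum>b<p. \<Sum>a<q. a ^ Suc k + Suc k * a ^ k * (b * q))] (mod p * q)"
    unfolding residue_power_sum_mult
    by (intro cong_sum cong_dvd_modulus_nat[OF power_add_multiple_cong modulus])
  also have "(\<Sum>b<p. \<Sum>a<q. a ^ Suc k + c * a ^ k * (b * q))
       = p * T + c * q * U * (\<Sum>b<p. b)" for c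
    unfolding sum.distrib T_def U_def residue_power_sum_def
    by (simp add: sum_distrib_left sum_distrib_right mult_ac del: power_Suc)
      (rule sum.swap)
  also have "Suc k * q * U * (\<Sum>b<p. b) = p * q * h"
  proof -
    have "2 * (Suc k * q * U * (\<Sum>b<p. b)) = Suc k * q * U * (2 * (\<Sum>b<p. b))"
      by (simp only: mult_ac)
    also have "\<dots> = p * q * (Suc k * (p - 1) * U)"
      by (simp only: gauss mult_ac)
    also have "\<dots> = 2 * (p * q * h)"
      unfolding h by simp
    finally show ?thesis by simp
  qed
  finally have "[residue_power_sum (Suc k) (p * q) = p * T + p * q * h] (mod p * q)" .
  hence "p * q dvd residue_power_sum (Suc k) (p * q) \<longleftrightarrow> p * q dvd p * T + p * q * h"
    by (rule cong_dvd_iff)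
  also have "\<dots> \<longleftrightarrow> p * q dvd p * T"
    by (simp add: dvd_add_left_iff)
  also have "\<dots> \<longleftrightarrow> q dvd T"
    using \<open>p > 0\<close> by simp
  finally show ?thesis unfolding T_def .
qed

text \<open>
  If \<open>p - 1\<close> divides \<open>k\<close>, then all nonzero residues contribute \<open>1\<close>, so that the sum is \<open>-1\<close>
  modulo \<open>p\<close>.  Otherwise, multiplication by a primitive root \<open>g\<close> permutes the residues and
  multiplies the sum by \<open>g ^ k\<close>, which is not \<open>1\<close>; hence the sum vanishes modulo \<open>p\<close>.
\<close>

lemma prime_dvd_residue_power_sum_iff:
  assumes "prime p" and "k > 0"
  shows "p dvd residue_power_sum k p \<longleftrightarrow> \<not> (p - 1) dvd k"
proof
  assume dvd: "p dvd residue_power_sum k p"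
  show "\<not> (p - 1) dvd k"
  proof
    assume "(p - 1) dvd k"
    then obtain c where c: "k = (p - 1) * c" by auto
    have "residue_power_sum k p = (\<Sum>j\<in>{1..<p}. j ^ k)"
      unfolding residue_power_sum_def using assms(2)
      by (intro sum.mono_neutral_right) (auto simp: Suc_le_eq)
    also have "[\<dots> = (\<Sum>j\<in>{1..<p}. 1)] (mod p)"
    proof (rule cong_sum)
      fix j assume j: "j \<in> {1..<p}"
      hence "[j ^ (p - 1) = 1] (mod p)"
        by (intro fermat_theorem assms) (auto dest: dvd_imp_le)
      hence "[(j ^ (p - 1)) ^ c = 1 ^ c] (mod p)" by (rule cong_pow)
      thus "[j ^ k = 1] (mod p)" by (simp add: c power_mult)
    qed
    finally have "[residue_power_sum k p = p - 1] (mod p)" by simp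
    hence "p dvd p - 1" using dvd by (simp add: cong_dvd_iff)
    thus False using prime_gt_1_nat[OF assms(1)] by (auto dest: dvd_imp_le)
  qed
next
  assume ndvd: "\<not> (p - 1) dvd k"
  define T where "T = residue_power_sum k p"
  have p: "p > 1" using assms(1) by (rule prime_gt_1_nat)
  obtain g where "residue_primroot p g"
    using prime_primitive_root_exists[OF p assms(1)] by blast
  hence g: "coprime p g" "ord p g = p - 1"
    using assms(1) by (simp_all add: residue_primroot_def totient_prime)
  have inj: "inj_on (\<lambda>a. g * a mod p) {..<p}"
  proof (rule inj_onI)
    fix a b assume ab: "a \<in> {..<p}" "b \<in> {..<p}" "g * a mod p = g * b mod p"
    hence "[a = b] (mod p)"
      using cong_mult_lcancel_nat[of g p a b] g(1) by (simp add: cong_def coprime_commute)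
    thus "a = b" using ab by (simp add: cong_def)
  qed
  have "bij_betw (\<lambda>a. g * a mod p) {..<p} {..<p}"
    using inj p by (intro bij_betw_imageI endo_inj_surj) auto
  hence "T = (\<Sum>a<p. (g * a mod p) ^ k)"
    unfolding T_def residue_power_sum_def by (rule sum.reindex_bij_betw[symmetric])
  also have "[\<dots> = (\<Sum>a<p. (g * a) ^ k)] (mod p)"
    by (intro cong_sum cong_pow) (simp add: cong_def)
  also have "(\<Sum>a<p. (g * a) ^ k) = g ^ k * T"
    by (simp add: T_def residue_power_sum_def power_mult_distrib sum_distrib_left)
  \<comment> \<open>The factor \<open>1\<close> is kept so that cancelling \<open>T\<close> leaves \<open>g ^ k\<close> congruent to \<open>1\<close>.\<close>
  finally have inv: "[1 * T = g ^ k * T] (mod p)" by simp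
  show "p dvd residue_power_sum k p"
  proof (rule ccontr)
    assume "\<not> p dvd residue_power_sum k p"
    hence "coprime T p"
      using assms(1) by (simp add: T_def prime_imp_coprime coprime_commute)
    hence "[1 = g ^ k] (mod p)"
      using inv by (simp only: cong_mult_rcancel_nat)
    hence "ord p g dvd k" by (simp add: ord_divides[symmetric] cong_sym_eq)
    thus False using ndvd g(2) by simp
  qed
qed

lemma prime_power_dvd_residue_power_sum_iff:
  assumes "prime p" and "k > 0" and par: "odd p \<or> even k" and "r > 0"
  shows "p ^ r dvd residue_power_sum k (p ^ r) \<longleftrightarrow> \<not> (p - 1) dvd k"
proof -
  obtain l where l: "k = Suc l" using assms(2) gr0_implies_Suc by blast
  have step: "p ^ Suc r dvd residue_power_sum k (p ^ Suc r) \<longleftrightarrow> p ^ r dvd residue_power_sum k (p ^ r)"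
    if "r > 0" for r
    unfolding l power_Suc using that par prime_gt_0_nat[OF assms(1)]
    by (intro dvd_residue_power_sum_mult_step) (auto simp: l dvd_power)
  from \<open>r > 0\<close> show ?thesis
  proof (induction r rule: nat_induct_non_zero)
    case 1
    thus ?case using prime_dvd_residue_power_sum_iff[OF assms(1,2)] by simp
  next
    case (Suc r)
    thus ?case using step[OF Suc.hyps] by blast
  qed
qed

section \<open>Powers of two\<close>

text \<open>
  For \<open>p = 2\<close> and odd \<open>k \<ge> 3\<close> the step from \<open>2\<close> to \<open>4\<close> breaks down: \<open>4\<close> divides the sum of
  powers modulo \<open>4\<close>, whereas the sum modulo \<open>2\<close> is odd.  So \<open>4\<close> has to be the base of the
  induction.  The sum is \<open>1 + 2 ^ k + 3 ^ k\<close>, where \<open>3 ^ k\<close> is \<open>-1\<close> modulo \<open>4\<close>.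
\<close>

lemma four_dvd_residue_power_sum_odd_iff:
  assumes "odd k"
  shows "4 dvd residue_power_sum k 4 \<longleftrightarrow> k \<ge> 3"
proof -
  obtain l where l: "k = Suc (2 * l)" using assms by (auto elim: oddE)
  have T: "residue_power_sum k 4 = 1 + 2 ^ k + 3 ^ k"
  proof -
    have "{..<4} = {0, 1, 2, 3::nat}" by auto
    thus ?thesis by (simp add: residue_power_sum_def l)
  qed
  have "[(9::nat) ^ l = 1 ^ l] (mod 4)" by (intro cong_pow) (simp add: cong_def)
  hence "[3 * 9 ^ l = 3 * 1 ^ l] (mod (4::nat))" by (intro cong_mult) auto
  hence "[1 + 2 ^ k + 3 ^ k = 1 + 2 ^ k + (3::nat)] (mod 4)"
    by (intro cong_add) (simp_all add: l power_mult)
  hence "4 dvd residue_power_sum k 4 \<longleftrightarrow> 4 dvd 1 + 2 ^ k + (3::nat)"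
    unfolding T by (rule cong_dvd_iff)
  also have "1 + 2 ^ k + (3::nat) = 2 ^ k + 4" by simp
  also have "4 dvd 2 ^ k + (4::nat) \<longleftrightarrow> 2 ^ 2 dvd (2::nat) ^ k" by (simp add: dvd_add_left_iff)
  also have "\<dots> \<longleftrightarrow> k \<ge> 2" by (subst dvd_power_iff_le) auto
  also have "\<dots> \<longleftrightarrow> k \<ge> 3" using l by presburger
  finally show ?thesis .
qed

text \<open>
  For even \<open>k\<close> or \<open>m = 1\<close> divisibility fails because \<open>2 - 1\<close> divides every \<open>k\<close>.  For odd \<open>k\<close>, the
  problem reduces to \<open>m = 2\<close>, since the sum with exponent \<open>k - 1\<close> over the residues modulo
  \<open>2 ^ m\<close> consists of \<open>2 ^ (m - 1)\<close> periods modulo \<open>2\<close> and so is even for \<open>m \<ge> 2\<close>.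
\<close>

lemma two_power_dvd_residue_power_sum_iff:
  assumes "k > 0" and "m > 0"
  shows "2 ^ m dvd residue_power_sum k (2 ^ m) \<longleftrightarrow> odd k \<and> k \<ge> 3 \<and> m \<ge> 2"
proof (cases "odd k \<and> m \<ge> 2")
  case False
  thus ?thesis
    using prime_power_dvd_residue_power_sum_iff[of 2 k m]
      prime_dvd_residue_power_sum_iff[of 2 k] assms
    by (cases "m = 1") auto
next
  case True
  hence "odd k" "m \<ge> 2" by auto
  obtain l where l: "k = Suc l" using assms(1) gr0_implies_Suc by blast
  have lift: "2 ^ Suc m dvd residue_power_sum k (2 ^ Suc m) \<longleftrightarrow> 2 ^ m dvd residue_power_sum k (2 ^ m)"
    if "m \<ge> 2" for m
  proof -
    have "even (residue_power_sum l (2 ^ (m - 1) * 2))"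
      using residue_power_sum_mult_cong[of l "2 ^ (m - 1)" 2] that
      by (subst cong_dvd_iff) auto
    moreover have "(2::nat) ^ (m - 1) * 2 = 2 ^ m"
      using that by (cases m) auto
    ultimately show ?thesis
      unfolding l power_Suc using that by (intro dvd_residue_power_sum_mult_step) (auto simp: dvd_power)
  qed
  from \<open>m \<ge> 2\<close> have "2 ^ m dvd residue_power_sum k (2 ^ m) \<longleftrightarrow> k \<ge> 3"
  proof (induction m rule: dec_induct)
    case base
    thus ?case using four_dvd_residue_power_sum_odd_iff[OF \<open>odd k\<close>] by simp
  next
    case (step m)
    thus ?case using lift[of m] by blast
  qed
  thus ?thesis using True by simp
qed

section \<open>The exponent of two in the Carmichael function\<close>

text \<open>Halving \<open>l\<close> keeps it a multiple of \<open>d\<close> iff the cofactor of \<open>d\<close> in \<open>l\<close> is even.\<close>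

lemma dvd_half_iff_multiplicity_less:
  fixes d l :: nat
  assumes "d dvd l" and "even l" and "l > 0"
  shows "d dvd l div 2 \<longleftrightarrow> multiplicity 2 d < multiplicity 2 l"
proof -
  obtain c where c: "l = d * c" using assms(1) by auto
  hence nz: "d > 0" "c > 0" using assms(3) by auto
  have "d dvd l div 2 \<longleftrightarrow> d * 2 dvd l" using assms(2) by (simp add: dvd_div_iff_mult)
  also have "\<dots> \<longleftrightarrow> even c" using nz by (simp add: c)
  also have "\<dots> \<longleftrightarrow> multiplicity 2 c > 0"
    using nz by (simp add: multiplicity_gt_zero_iff)
  also have "\<dots> \<longleftrightarrow> multiplicity 2 d < multiplicity 2 l"
    using nz by (simp add: c prime_elem_multiplicity_mult_distrib)
  finally show ?thesis .
qed

lemma multiplicity_LCM_attained: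
  fixes f :: "'b \<Rightarrow> nat"
  assumes "finite A" and "A \<noteq> {}" and "\<And>i. i \<in> A \<Longrightarrow> f i > 0" and "prime q"
  shows "\<exists>j\<in>A. multiplicity q (LCM i\<in>A. f i) = multiplicity q (f j)"
  using assms
proof (induction A rule: finite_ne_induct)
  case (insert x A)
  then obtain j where j: "j \<in> A" "multiplicity q (LCM i\<in>A. f i) = multiplicity q (f j)" by auto
  have "f x \<noteq> 0" and "0 \<notin> f ` A" using insert.prems(1) by fastforce+
  hence "(LCM i\<in>A. f i) \<noteq> 0" using insert.hyps(1) by (simp add: Lcm_0_iff)
  with \<open>f x \<noteq> 0\<close> have "multiplicity q (LCM i\<in>insert x A. f i) = max (multiplicity q (f x)) (multiplicity q (f j))"
    using insert.prems j(2) by (simp add: multiplicity_lcm)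
  thus ?case using j(1) by (auto simp: max_def)
qed auto

lemma prod_coprime_dvd_iff:
  fixes f :: "'b \<Rightarrow> nat"
  assumes "finite A" and "\<And>i j. i \<in> A \<Longrightarrow> j \<in> A \<Longrightarrow> i \<noteq> j \<Longrightarrow> coprime (f i) (f j)"
  shows "(\<Prod>i\<in>A. f i) dvd x \<longleftrightarrow> (\<forall>i\<in>A. f i dvd x)"
  using assms
proof (induction A rule: finite_induct)
  case (insert y A)
  have "coprime (f y) (\<Prod>i\<in>A. f i)"
    using insert by (intro prod_coprime_right) auto
  hence "f y * (\<Prod>i\<in>A. f i) dvd x \<longleftrightarrow> f y dvd x \<and> (\<Prod>i\<in>A. f i) dvd x"
    by (auto intro: divides_mult dest: dvd_mult_left dvd_mult_right)
  thus ?case using insert by simp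
qed simp

text \<open>
  The unit \<open>2\<close> alone suffices: its square must be \<open>1\<close> modulo \<open>N\<close>, that is, \<open>N\<close> divides \<open>3\<close>.
\<close>

lemma odd_Carmichael_dvd_2_imp_eq_3:
  assumes "odd N" and "N > 1" and "Carmichael N dvd 2"
  shows "N = 3"
proof -
  have "[2 ^ 2 = 1] (mod N)"
    using assms Carmichael_divides[of N 2 2] by simp
  hence "N dvd 3" using cong_to_1_nat[of "2 ^ 2" N] by (simp add: cong_altdef_nat)
  moreover have "prime (3::nat)" by simp
  ultimately have "N = 1 \<or> N = 3" unfolding prime_nat_iff by blast
  thus ?thesis using assms(2) by simp
qed

section \<open>The characterisation\<close>

theorem proposition12:
  fixes m s n :: nat and p r :: "nat \<Rightarrow> nat"
  assumes "s > 0"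
    and "\<And>i. i \<in> {1..s} \<Longrightarrow> prime (p i) \<and> odd (p i)"
    and "inj_on p {1..s}"
    and "\<And>i. i \<in> {1..s} \<Longrightarrow> r i \<ge> 1"
    and "n = 2 ^ m * (\<Prod>i=1..s. p i ^ r i)"
  shows "n \<in> M_half_lambda \<longleftrightarrow>
      (m = 0 \<and> (\<forall>i\<in>{1..s}. \<forall>j\<in>{1..s}. multiplicity 2 (p i - 1) = multiplicity 2 (p j - 1))) \<or>
      ((m = 2 \<or> m = 3) \<and> (\<forall>i\<in>{1..s}. multiplicity 2 (p i - 1) = 1) \<and> n div 2 ^ m \<noteq> 3)"
proof -
  note prm = assms(2) and inj = assms(3)
  define f where "f = (\<lambda>i. p i ^ r i)"
  define N where "N = (\<Prod>i=1..s. f i)"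
  define k where "k = Carmichael n div 2"
  define e where "e = (\<lambda>i. multiplicity 2 (p i - 1))"
  define E where "E = multiplicity 2 (Carmichael n)"
  have n: "n = 2 ^ m * N" using assms(5) by (simp add: N_def f_def)
  have p3: "p i \<ge> 3" if "i \<in> {1..s}" for i
    using prm[OF that] prime_ge_2_nat[of "p i"] by (cases "p i = 2") auto
  have r: "r i > 0" if "i \<in> {1..s}" for i using assms(4)[OF that] by simp
  have cop: "coprime (f i) (f j)" if "i \<in> {1..s}" "j \<in> {1..s}" "i \<noteq> j" for i j
  proof -
    have "p i \<noteq> p j" using inj that by (auto dest: inj_onD)
    thus ?thesis using prm that by (auto simp: f_def intro: primes_coprime)
  qed
  have "odd N" using prm by (auto simp: N_def f_def even_prod_iff)
  have "N > 1"
  proof -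
    have "f 1 dvd N" unfolding N_def using assms(1) by (intro dvd_prodI) auto
    moreover have "f 1 > 1"
      using p3[of 1] r[of 1] assms(1) unfolding f_def by (intro one_less_power) auto
    moreover have "N > 0" using \<open>odd N\<close> by (rule odd_pos)
    ultimately show ?thesis by (auto dest: dvd_imp_le)
  qed
  with \<open>odd N\<close> have "N \<ge> 3" by (cases "N = 2") auto
  have "N \<le> n" by (simp add: n)
  with \<open>N \<ge> 3\<close> have "n \<ge> 3" by simp
  hence even: "even (Carmichael n)" by (rule Defs.even_Carmichael)
  hence L: "Carmichael n = 2 * k" by (simp add: k_def)
  hence "k > 0" using Carmichael_pos[of n] by linarith

  have coN: "coprime (2 ^ m) N" using \<open>odd N\<close> by simp
  have C: "Carmichael n = lcm (Carmichael (2 ^ m)) (Carmichael N)"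
    unfolding n using coN by (rule Carmichael_mult_coprime)
  have CN: "Carmichael N = (LCM i\<in>{1..s}. Carmichael (f i))"
    unfolding N_def using cop by (intro Carmichael_prod_coprime) auto
  have Cf: "Carmichael (f i) = p i ^ (r i - 1) * (p i - 1)" if "i \<in> {1..s}" for i
    unfolding f_def using prm[OF that] r[OF that] by (intro Carmichael_odd_prime_power) auto
  have mult_Cf: "multiplicity 2 (Carmichael (f i)) = e i" if "i \<in> {1..s}" for i
  proof -
    have "multiplicity 2 (p i ^ (r i - 1)) = 0"
      using prm[OF that] by (intro not_dvd_imp_multiplicity_0) simp
    thus ?thesis using p3[OF that] prm[OF that]
      by (simp add: Cf[OF that] e_def prime_elem_multiplicity_mult_distrib)
  qed
  have dvd_L: "p i - 1 dvd Carmichael n" if "i \<in> {1..s}" for i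
  proof -
    have "p i - 1 dvd Carmichael (f i)" by (simp add: Cf[OF that])
    also have "\<dots> dvd Carmichael N" unfolding CN using that by auto
    also have "\<dots> dvd Carmichael n" unfolding C by simp
    finally show ?thesis .
  qed
  have e_le: "e i \<le> E" if "i \<in> {1..s}" for i
    unfolding e_def E_def using dvd_L[OF that] by (intro dvd_imp_multiplicity_le) auto
  have e_pos: "e i > 0" if "i \<in> {1..s}" for i
    unfolding e_def using p3[OF that] prm[OF that] by (simp add: multiplicity_gt_zero_iff)
  obtain j where j: "j \<in> {1..s}" "multiplicity 2 (Carmichael N) = e j"
    using multiplicity_LCM_attained[of "{1..s}" "\<lambda>i. Carmichael (f i)" 2] assms(1)
    by (auto simp: CN mult_Cf)
  have E: "E = max (multiplicity 2 (Carmichael (2 ^ m))) (e j)"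
    unfolding E_def C using j(2) by (simp add: multiplicity_lcm)

  have local: "f i dvd power_sum k n \<longleftrightarrow> e i = E" if i: "i \<in> {1..s}" for i
  proof -
    define c where "c = 2 ^ m * (\<Prod>l\<in>{1..s} - {i}. f l)"
    have c: "n = c * f i"
      using prod.remove[of "{1..s}" i f] i by (simp add: n N_def c_def)
    have "odd (f i)" using prm[OF i] by (simp add: f_def)
    moreover have "coprime (f i) (\<Prod>l\<in>{1..s} - {i}. f l)"
      using i by (intro prod_coprime_right cop) auto
    ultimately have "coprime (f i) c" by (simp add: c_def)
    have "f i dvd power_sum k n \<longleftrightarrow> f i dvd residue_power_sum k n"
      using \<open>k > 0\<close> by (intro dvd_power_sum_iff) (auto simp: c)
    also have "\<dots> \<longleftrightarrow> f i dvd residue_power_sum k (f i)"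
      unfolding c using \<open>coprime (f i) c\<close> by (rule dvd_residue_power_sum_mult_coprime_iff)
    also have "\<dots> \<longleftrightarrow> \<not> (p i - 1) dvd k"
      unfolding f_def using prm[OF i] r[OF i] \<open>k > 0\<close>
      by (intro prime_power_dvd_residue_power_sum_iff) auto
    also have "\<dots> \<longleftrightarrow> \<not> e i < E"
      unfolding k_def e_def E_def using dvd_L[OF i] even
      by (subst dvd_half_iff_multiplicity_less) auto
    finally show ?thesis using e_le[OF i] by auto
  qed
  have "N dvd power_sum k n \<longleftrightarrow> (\<forall>i\<in>{1..s}. e i = E)"
    unfolding N_def using cop local by (subst prod_coprime_dvd_iff) auto
  moreover have "n dvd power_sum k n \<longleftrightarrow> 2 ^ m dvd power_sum k n \<and> N dvd power_sum k n"
    unfolding n using coN by (auto intro: divides_mult dest: dvd_mult_left dvd_mult_right)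
  ultimately have main: "n \<in> M_half_lambda \<longleftrightarrow> 2 ^ m dvd power_sum k n \<and> (\<forall>i\<in>{1..s}. e i = E)"
    using \<open>n \<ge> 3\<close> by (simp add: M_half_lambda_def k_def)

  show ?thesis
  proof (cases "m = 0")
    case True
    hence "E = e j" using E by simp
    hence "(\<forall>i\<in>{1..s}. e i = E) \<longleftrightarrow> (\<forall>i\<in>{1..s}. \<forall>j\<in>{1..s}. e i = e j)"
      using j(1) by metis
    thus ?thesis using main True by (simp add: e_def)
  next
    case False
    have "2 ^ m dvd power_sum k n \<longleftrightarrow> 2 ^ m dvd residue_power_sum k n"
      using \<open>k > 0\<close> by (intro dvd_power_sum_iff) (auto simp: n)
    also have "\<dots> \<longleftrightarrow> 2 ^ m dvd residue_power_sum k (2 ^ m)"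
      using coN by (simp add: n mult.commute[of _ N] dvd_residue_power_sum_mult_coprime_iff)
    also have "\<dots> \<longleftrightarrow> odd k \<and> k \<ge> 3 \<and> m \<ge> 2"
      using \<open>k > 0\<close> False by (intro two_power_dvd_residue_power_sum_iff) auto
    finally have two: "2 ^ m dvd power_sum k n \<longleftrightarrow> odd k \<and> k \<ge> 3 \<and> m \<ge> 2" .
    have "E = Suc (multiplicity 2 k)"
      using \<open>k > 0\<close> by (simp add: E_def L prime_elem_multiplicity_mult_distrib)
    hence odd_k: "odd k \<longleftrightarrow> E = 1"
      using \<open>k > 0\<close> by (simp add: multiplicity_eq_zero_iff)
    have m23: "Carmichael (2 ^ m) = 2" if "m = 2 \<or> m = 3"
      using that by (auto simp: Carmichael_twopow)
    \<comment> \<open>Here \<open>m - 2 \<ge> 2\<close>, so \<open>2 ^ m\<close> alone already makes \<open>\<lambda>(n)\<close> divisible by \<open>4\<close>.\<close>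
    have m_ge_4: "E \<noteq> 1" if "m \<ge> 4"
    proof -
      have "multiplicity 2 (Carmichael (2 ^ m)) = m - 2"
        using that by (simp add: Carmichael_twopow)
      thus ?thesis using E that by auto
    qed
    have k1: "k = 1 \<longleftrightarrow> N = 3" if "m = 2 \<or> m = 3"
    proof
      assume "k = 1"
      hence "Carmichael N dvd 2" using C L by (metis dvd_lcm2 mult.right_neutral)
      thus "N = 3" using odd_Carmichael_dvd_2_imp_eq_3 \<open>odd N\<close> \<open>N > 1\<close> by blast
    next
      assume "N = 3"
      hence "Carmichael N = 2" by (simp add: Carmichael_prime)
      thus "k = 1" using C m23[OF that] L by simp
    qed
    have E1: "E = 1" if "m = 2 \<or> m = 3" "\<forall>i\<in>{1..s}. e i = 1"
      using E m23[OF that(1)] that(2) j(1) by simp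
    have k3: "k \<ge> 3 \<longleftrightarrow> k \<noteq> 1" if "odd k"
      using that by (auto elim!: oddE)
    have "n div 2 ^ m = N" by (simp add: n)
    moreover have "2 ^ m dvd power_sum k n \<and> (\<forall>i\<in>{1..s}. e i = E) \<longleftrightarrow>
        (m = 2 \<or> m = 3) \<and> (\<forall>i\<in>{1..s}. e i = 1) \<and> N \<noteq> 3"
    proof
      assume lhs: "2 ^ m dvd power_sum k n \<and> (\<forall>i\<in>{1..s}. e i = E)"
      hence "E = 1" "m \<ge> 2" "k \<ge> 3" using two odd_k by auto
      moreover from this have "m = 2 \<or> m = 3" using m_ge_4 by linarith
      ultimately show "(m = 2 \<or> m = 3) \<and> (\<forall>i\<in>{1..s}. e i = 1) \<and> N \<noteq> 3"
        using lhs k1 by auto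
    next
      assume "(m = 2 \<or> m = 3) \<and> (\<forall>i\<in>{1..s}. e i = 1) \<and> N \<noteq> 3"
      thus "2 ^ m dvd power_sum k n \<and> (\<forall>i\<in>{1..s}. e i = E)"
        using two odd_k E1 k1 k3 by auto
    qed
    ultimately show ?thesis using main False by (simp add: e_def)
  qed
qed

end
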